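(* Let $\alpha$ and $\beta$ be non-negative increasing sequences tending to infinity and let $\Lambda_1(\beta)$ be a nuclear power series space of finite type. For every $\theta=(\theta_n)_{n\in\mathbb{N}_0}\in(\Lambda_1(\alpha))'$, the Hankel operator $H_\theta:\Lambda_1(\alpha)\to\Lambda_1(\beta)$ is well-defined, continuous and compact.
   Context: $\mathbb{N}=\{1,2,\dots\}$, $\mathbb{N}_0=\mathbb{N}\cup\{0\}$. For a non-negative increasing sequence $\alpha=(\alpha_n)_{n\in\mathbb{N}}$ with $\alpha_n\to\infty$, the power series space of finite type is the Fréchet space $\Lambda_1(\alpha)=\{x=(x_n)_{n\in\mathbb{N}}:\ \|x\|_k:=\sum_{n=1}^\infty|x_n|e^{-\frac1k\alpha_n}<\infty\ \text{for all }k\in\mathbb{N}\}$ with the seminorms $\|\cdot\|_k$, $k\in\mathbb{N}$. Its dual is identified with the sequence space $(\Lambda_1(\alpha))'=\{y=(y_n)_{n\in\mathbb{N}}:\ \sup_n|y_n|e^{\frac1k\alpha_n}<\infty\ \text{for some }k\in\mathbb{N}\}$. By the Grothendieck–Pietsch criterion, $\Lambda_1(\beta)$ is nuclear if and only if for every $k\in\mathbb{N}$ there is $l>k$ with $\sum_{n=1}^\infty e^{-\frac1k\beta_n}/e^{-\frac1l\beta_n}<\infty$. The sequence $e_n$ has $1$ in the $n$-th place and $0$ elsewhere. A sequence $\theta=(\theta_n)_{n\in\mathbb{N}_0}$ is identified with the sequence $(\theta_{n-1})_{n\in\mathbb{N}}=(\theta_0,\theta_1,\theta_2,\dots)$ when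 it is said to belong to a sequence space. The Hankel operator $H_\theta:E\to F$ between such sequence spaces is given by $H_\theta e_n=(\theta_{n-1},\theta_n,\theta_{n+1},\dots)=\sum_{j=1}^\infty\theta_{j+n-2}e_j$ for $n\in\mathbb{N}$ and $H_\theta x=\sum_{n=1}^\infty x_nH_\theta e_n$ for $x=(x_n)\in E$. It is well-defined if $H_\theta e_n\in F$ for all $n$ and the series $\sum_n x_nH_\theta e_n$ converges in $F$ for every $x\in E$. A linear map $T:E\to F$ between Fréchet spaces is compact if $T(U)$ is precompact in $F$ for some neighborhood $U$ of zero in $E$. *)

theory Defs
  imports "HOL-Analysis.Analysis"
begin

text \<open>
  Sequences indexed by \<open>\<nat> = {1, 2, \<dots>}\<close> are encoded as functions on \<^typ>\<open>nat\<close> with the index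
  shifted by one: position \<open>i\<close> holds the entry with index \<open>i + 1\<close>.  Under this encoding the
  identification of \<open>(\<theta>\<^sub>n)\<close>, \<open>n \<ge> 0\<close>, with \<open>(\<theta>\<^sub>n\<^sub>-\<^sub>1)\<close>, \<open>n \<ge> 1\<close>, is the identity.  The indices \<open>k\<close> of
  the seminorms are not shifted, so they are restricted to \<open>k \<ge> 1\<close>.

  The scalars are a type of sort \<open>{real_normed_field, heine_borel}\<close>; up to isometric isomorphism
  these are exactly the real and the complex numbers.
\<close>


section \<open>Power series spaces of finite type\<close>

definition exponent_sequence :: "(nat \<Rightarrow> real) \<Rightarrow> bool" where
  "exponent_sequence \<alpha> \<longleftrightarrow> (\<forall>n. 0 \<le> \<alpha> n) \<and> mono \<alpha> \<and> filterlim \<alpha> at_top sequentially"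

definition Lambda1 :: "(nat \<Rightarrow> real) \<Rightarrow> (nat \<Rightarrow> 'a::real_normed_field) set" where
  "Lambda1 \<alpha> = {x. \<forall>k\<ge>1. summable (\<lambda>n. norm (x n) * exp (- (1 / real k) * \<alpha> n))}"

definition Lambda1_norm :: "(nat \<Rightarrow> real) \<Rightarrow> nat \<Rightarrow> (nat \<Rightarrow> 'a::real_normed_field) \<Rightarrow> real" where
  "Lambda1_norm \<alpha> k x = (\<Sum>n. norm (x n) * exp (- (1 / real k) * \<alpha> n))"

definition Lambda1_ball ::
    "(nat \<Rightarrow> real) \<Rightarrow> nat \<Rightarrow> (nat \<Rightarrow> 'a::real_normed_field) \<Rightarrow> real \<Rightarrow> (nat \<Rightarrow> 'a) set" where
  "Lambda1_ball \<alpha> k x r = {y \<in> Lambda1 \<alpha>. Lambda1_norm \<alpha> k (\<lambda>n. y n - x n) < r}"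

definition Lambda1_top :: "(nat \<Rightarrow> real) \<Rightarrow> (nat \<Rightarrow> 'a::real_normed_field) topology" where
  "Lambda1_top \<alpha> =
     topology_generated_by {Lambda1_ball \<alpha> k x r | k x r. 1 \<le> k \<and> x \<in> Lambda1 \<alpha> \<and> 0 < r}"

definition Lambda1_dual :: "(nat \<Rightarrow> real) \<Rightarrow> (nat \<Rightarrow> 'a::real_normed_field) set" where
  "Lambda1_dual \<alpha> = {y. \<exists>k\<ge>1. bdd_above (range (\<lambda>n. norm (y n) * exp ((1 / real k) * \<alpha> n)))}"


section \<open>Notions for locally convex sequence spaces\<close>

text \<open>A locally convex sequence space is given by its topology \<open>T\<close>; its carrier is \<open>topspace T\<close>,
  and the vector space operations are the pointwise ones.\<close>

definition linear_functional_on ::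
    "(nat \<Rightarrow> 'a::real_normed_field) set \<Rightarrow> ((nat \<Rightarrow> 'a) \<Rightarrow> 'a) \<Rightarrow> bool" where
  "linear_functional_on E \<phi> \<longleftrightarrow>
     (\<forall>x\<in>E. \<forall>y\<in>E. \<phi> (\<lambda>n. x n + y n) = \<phi> x + \<phi> y) \<and>
     (\<forall>c. \<forall>x\<in>E. \<phi> (\<lambda>n. c * x n) = c * \<phi> x)"

definition linear_operator_on ::
    "(nat \<Rightarrow> 'a::real_normed_field) set \<Rightarrow> (nat \<Rightarrow> 'a) set \<Rightarrow>
     ((nat \<Rightarrow> 'a) \<Rightarrow> (nat \<Rightarrow> 'a)) \<Rightarrow> bool" where
  "linear_operator_on E F A \<longleftrightarrow>
     A ` E \<subseteq> F \<and>
     (\<forall>x\<in>E. \<forall>y\<in>E. A (\<lambda>n. x n + y n) = (\<lambda>n. A x n + A y n)) \<and>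
     (\<forall>c. \<forall>x\<in>E. A (\<lambda>n. c * x n) = (\<lambda>n. c * A x n))"

definition zero_neighbourhood ::
    "(nat \<Rightarrow> 'a::real_normed_field) topology \<Rightarrow> (nat \<Rightarrow> 'a) set \<Rightarrow> bool" where
  "zero_neighbourhood T U \<longleftrightarrow> U \<subseteq> topspace T \<and> (\<exists>V. openin T V \<and> (\<lambda>_. 0) \<in> V \<and> V \<subseteq> U)"

definition precompact_in ::
    "(nat \<Rightarrow> 'a::real_normed_field) topology \<Rightarrow> (nat \<Rightarrow> 'a) set \<Rightarrow> bool" where
  "precompact_in T A \<longleftrightarrow>
     A \<subseteq> topspace T \<and>
     (\<forall>V. zero_neighbourhood T V \<longrightarrow>
        (\<exists>M. finite M \<and> M \<subseteq> topspace T \<and> A \<subseteq> (\<Union>x\<in>M. (\<lambda>v n. x n + v n) ` V)))"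

definition compact_operator ::
    "(nat \<Rightarrow> 'a::real_normed_field) topology \<Rightarrow> (nat \<Rightarrow> 'a) topology \<Rightarrow>
     ((nat \<Rightarrow> 'a) \<Rightarrow> (nat \<Rightarrow> 'a)) \<Rightarrow> bool" where
  "compact_operator S T A \<longleftrightarrow>
     linear_operator_on (topspace S) (topspace T) A \<and>
     (\<exists>U. zero_neighbourhood S U \<and> precompact_in T (A ` U))"

definition continuous_seminorm ::
    "(nat \<Rightarrow> 'a::real_normed_field) topology \<Rightarrow> ((nat \<Rightarrow> 'a) \<Rightarrow> real) \<Rightarrow> bool" where
  "continuous_seminorm T p \<longleftrightarrow>
     continuous_map T euclideanreal p \<and>
     (\<forall>x\<in>topspace T. 0 \<le> p x) \<and>
     (\<forall>x\<in>topspace T. \<forall>y\<in>topspace T. p (\<lambda>n. x n + y n) \<le> p x + p y) \<and>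
     (\<forall>c. \<forall>x\<in>topspace T. p (\<lambda>n. c * x n) = norm c * p x)"

text \<open>
  Nuclearity: for every continuous seminorm \<open>p\<close> there is a continuous seminorm \<open>q \<ge> p\<close> such that the
  canonical map between the local Banach spaces \<open>E\<^sub>q \<rightarrow> E\<^sub>p\<close> (the completions of \<open>E / ker q\<close> and
  \<open>E / ker p\<close>) is nuclear, i.e. a norm convergent sum of rank one operators \<open>\<phi>\<^sub>i \<otimes> y\<^sub>i\<close> with
  \<open>\<Sum>\<^sub>i \<parallel>\<phi>\<^sub>i\<parallel>\<^sub>q * p y\<^sub>i < \<infinity>\<close>.  Functionals on the local Banach space \<open>E\<^sub>q\<close> are the linear functionals on
  \<open>E\<close> bounded by a multiple of \<open>q\<close>, and the \<open>y\<^sub>i\<close> can be taken from the dense image of \<open>E\<close> in \<open>E\<^sub>p\<close>,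
  so the completions need not be formed.
\<close>

definition nuclear_space :: "(nat \<Rightarrow> 'a::real_normed_field) topology \<Rightarrow> bool" where
  "nuclear_space T \<longleftrightarrow>
     (\<forall>p. continuous_seminorm T p \<longrightarrow>
       (\<exists>q. continuous_seminorm T q \<and> (\<forall>x\<in>topspace T. p x \<le> q x) \<and>
         (\<exists>\<phi> y c.
            (\<forall>i. linear_functional_on (topspace T) (\<phi> i)) \<and>
            (\<forall>i. 0 \<le> c i \<and> (\<forall>x\<in>topspace T. norm (\<phi> i x) \<le> c i * q x)) \<and>
            (\<forall>i. y i \<in> topspace T) \<and>
            summable (\<lambda>i. c i * p (y i)) \<and>
            (\<forall>x\<in>topspace T.
               (\<lambda>N. p (\<lambda>n. x n - (\<Sum>i<N. \<phi> i x * y i n))) \<longlonglongrightarrow> 0))))"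


section \<open>Hankel operators\<close>

definition hankel_column :: "(nat \<Rightarrow> 'a) \<Rightarrow> nat \<Rightarrow> (nat \<Rightarrow> 'a)" where
  "hankel_column \<theta> n = (\<lambda>j. \<theta> (j + n))"

definition hankel_sums ::
    "(nat \<Rightarrow> 'a::real_normed_field) topology \<Rightarrow> (nat \<Rightarrow> 'a) \<Rightarrow> (nat \<Rightarrow> 'a) \<Rightarrow> (nat \<Rightarrow> 'a) \<Rightarrow> bool"
  where
  "hankel_sums T \<theta> x y \<longleftrightarrow>
     limitin T (\<lambda>N j. \<Sum>n<N. x n * hankel_column \<theta> n j) y sequentially"

definition hankel_well_defined ::
    "(nat \<Rightarrow> 'a::real_normed_field) topology \<Rightarrow> (nat \<Rightarrow> 'a) topology \<Rightarrow> (nat \<Rightarrow> 'a) \<Rightarrow> bool" where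
  "hankel_well_defined S T \<theta> \<longleftrightarrow>
     (\<forall>n. hankel_column \<theta> n \<in> topspace T) \<and>
     (\<forall>x\<in>topspace S. \<exists>y. hankel_sums T \<theta> x y)"

text \<open>The operator depends on the target space only through the topology in which the series is
  summed; the sum is unique in any Hausdorff sequence space.\<close>

definition hankel ::
    "(nat \<Rightarrow> 'a::real_normed_field) topology \<Rightarrow> (nat \<Rightarrow> 'a) \<Rightarrow> (nat \<Rightarrow> 'a) \<Rightarrow> (nat \<Rightarrow> 'a)" where
  "hankel T \<theta> x = (THE y. hankel_sums T \<theta> x y)"


section \<open>The topology of power series spaces and the Grothendieck--Pietsch criterion\<close>

lemma Lambda1_summable:
  assumes "x \<in> Lambda1 \<alpha>" "1 \<le> k"
  shows "summable (\<lambda>n. norm (x n) * exp (- (1 / real k) * \<alpha> n))"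
  using assms unfolding Lambda1_def by blast

lemma Lambda1_zero: "(\<lambda>_. 0) \<in> Lambda1 \<alpha>"
  by (simp add: Lambda1_def)

lemma Lambda1_add:
  assumes "x \<in> Lambda1 \<alpha>" "y \<in> Lambda1 \<alpha>"
  shows "(\<lambda>n. x n + y n) \<in> Lambda1 \<alpha>"
  unfolding Lambda1_def
proof (intro CollectI allI impI)
  fix k :: nat assume k: "1 \<le> k"
  show "summable (\<lambda>n. norm (x n + y n) * exp (- (1 / real k) * \<alpha> n))"
  proof (rule summable_comparison_test')
    show "summable (\<lambda>n. norm (x n) * exp (- (1 / real k) * \<alpha> n) + norm (y n) * exp (- (1 / real k) * \<alpha> n))"
      by (intro summable_add Lambda1_summable assms k)
    show "norm (norm (x n + y n) * exp (- (1 / real k) * \<alpha> n))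
        \<le> norm (x n) * exp (- (1 / real k) * \<alpha> n) + norm (y n) * exp (- (1 / real k) * \<alpha> n)" for n
      using mult_right_mono[OF norm_triangle_ineq[of "x n" "y n"], of "exp (- (1 / real k) * \<alpha> n)"]
      by (simp add: distrib_right)
  qed
qed

lemma Lambda1_cmult:
  assumes "x \<in> Lambda1 \<alpha>"
  shows "(\<lambda>n. c * x n) \<in> Lambda1 \<alpha>"
  using assms unfolding Lambda1_def by (auto simp: norm_mult mult.assoc intro: summable_mult)

lemma Lambda1_diff:
  assumes "x \<in> Lambda1 \<alpha>" "y \<in> Lambda1 \<alpha>"
  shows "(\<lambda>n. x n - y n) \<in> Lambda1 \<alpha>"
  using Lambda1_add[OF assms(1) Lambda1_cmult[OF assms(2), of "-1"]] by simp

lemma Lambda1_norm_nonneg: "x \<in> Lambda1 \<alpha> \<Longrightarrow> 1 \<le> k \<Longrightarrow> 0 \<le> Lambda1_norm \<alpha> k x"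
  unfolding Lambda1_norm_def by (intro suminf_nonneg Lambda1_summable) auto

lemma Lambda1_norm_add:
  assumes "x \<in> Lambda1 \<alpha>" "y \<in> Lambda1 \<alpha>" "1 \<le> k"
  shows "Lambda1_norm \<alpha> k (\<lambda>n. x n + y n) \<le> Lambda1_norm \<alpha> k x + Lambda1_norm \<alpha> k y"
proof -
  have "Lambda1_norm \<alpha> k (\<lambda>n. x n + y n) \<le>
    (\<Sum>n. norm (x n) * exp (- (1 / real k) * \<alpha> n) + norm (y n) * exp (- (1 / real k) * \<alpha> n))"
    unfolding Lambda1_norm_def
  proof (rule suminf_le)
    show "norm (x n + y n) * exp (- (1 / real k) * \<alpha> n)
        \<le> norm (x n) * exp (- (1 / real k) * \<alpha> n) + norm (y n) * exp (- (1 / real k) * \<alpha> n)" for n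
      using mult_right_mono[OF norm_triangle_ineq[of "x n" "y n"], of "exp (- (1 / real k) * \<alpha> n)"]
      by (simp add: distrib_right)
  qed (intro summable_add Lambda1_summable assms Lambda1_add)+
  also have "\<dots> = Lambda1_norm \<alpha> k x + Lambda1_norm \<alpha> k y"
    unfolding Lambda1_norm_def by (intro suminf_add[symmetric] Lambda1_summable assms)
  finally show ?thesis .
qed

lemma Lambda1_norm_cmult:
  assumes "x \<in> Lambda1 \<alpha>" "1 \<le> k"
  shows "Lambda1_norm \<alpha> k (\<lambda>n. c * x n) = norm c * Lambda1_norm \<alpha> k x"
  unfolding Lambda1_norm_def using suminf_mult[OF Lambda1_summable[OF assms], of "norm c"]
  by (simp add: norm_mult mult.assoc)

lemma Lambda1_norm_minus: "Lambda1_norm \<alpha> k (\<lambda>n. x n - y n) = Lambda1_norm \<alpha> k (\<lambda>n. y n - x n)"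
  unfolding Lambda1_norm_def by (simp add: norm_minus_commute)

lemma Lambda1_norm_diff_triangle:
  assumes "x \<in> Lambda1 \<alpha>" "y \<in> Lambda1 \<alpha>" "z \<in> Lambda1 \<alpha>" "1 \<le> k"
  shows "Lambda1_norm \<alpha> k (\<lambda>n. x n - z n)
    \<le> Lambda1_norm \<alpha> k (\<lambda>n. x n - y n) + Lambda1_norm \<alpha> k (\<lambda>n. y n - z n)"
  using Lambda1_norm_add[OF Lambda1_diff[OF assms(1,2)] Lambda1_diff[OF assms(2,3)] assms(4)] by simp

lemma Lambda1_norm_mono:
  assumes "x \<in> Lambda1 \<alpha>" "\<forall>n. 0 \<le> \<alpha> n" "1 \<le> k" "k \<le> l"
  shows "Lambda1_norm \<alpha> k x \<le> Lambda1_norm \<alpha> l x"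
  unfolding Lambda1_norm_def
proof (rule suminf_le)
  fix n
  have "1 / real l * \<alpha> n \<le> 1 / real k * \<alpha> n"
    using assms by (intro mult_right_mono) (auto simp: frac_le)
  then show "norm (x n) * exp (- (1 / real k) * \<alpha> n) \<le> norm (x n) * exp (- (1 / real l) * \<alpha> n)"
    by (intro mult_left_mono) auto
next
  show "summable (\<lambda>n. norm (x n) * exp (- (1 / real k) * \<alpha> n))"
    by (rule Lambda1_summable[OF assms(1,3)])
  show "summable (\<lambda>n. norm (x n) * exp (- (1 / real l) * \<alpha> n))"
    using assms(3,4) by (intro Lambda1_summable[OF assms(1)]) simp
qed

lemma topspace_Lambda1_top [simp]: "topspace (Lambda1_top \<alpha>) = (Lambda1 \<alpha> :: (nat \<Rightarrow> 'a::real_normed_field) set)"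
proof
  show "topspace (Lambda1_top \<alpha>) \<subseteq> (Lambda1 \<alpha> :: (nat \<Rightarrow> 'a) set)"
    unfolding Lambda1_top_def topology_generated_by_topspace by (auto simp: Lambda1_ball_def)
  show "(Lambda1 \<alpha> :: (nat \<Rightarrow> 'a) set) \<subseteq> topspace (Lambda1_top \<alpha>)"
  proof
    fix x :: "nat \<Rightarrow> 'a" assume x: "x \<in> Lambda1 \<alpha>"
    then have "x \<in> Lambda1_ball \<alpha> 1 x 1"
      by (simp add: Lambda1_ball_def Lambda1_norm_def)
    moreover have "Lambda1_ball \<alpha> 1 x 1 \<in> {Lambda1_ball \<alpha> k x r | k x r. 1 \<le> k \<and> x \<in> Lambda1 \<alpha> \<and> 0 < r}"
      using x zero_less_one le_refl by blast
    ultimately show "x \<in> topspace (Lambda1_top \<alpha>)"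
      unfolding Lambda1_top_def topology_generated_by_topspace by (rule UnionI[rotated])
  qed
qed

lemma Lambda1_ball_nested:
  assumes "z \<in> Lambda1_ball \<alpha> k x r" "x \<in> Lambda1 \<alpha>" "1 \<le> k"
  shows "\<exists>e>0. Lambda1_ball \<alpha> k z e \<subseteq> Lambda1_ball \<alpha> k x r"
proof (intro exI conjI subsetI)
  show "0 < r - Lambda1_norm \<alpha> k (\<lambda>n. z n - x n)"
    using assms by (simp add: Lambda1_ball_def)
  fix w assume "w \<in> Lambda1_ball \<alpha> k z (r - Lambda1_norm \<alpha> k (\<lambda>n. z n - x n))"
  then show "w \<in> Lambda1_ball \<alpha> k x r"
    using assms Lambda1_norm_diff_triangle[of w \<alpha> z x k] by (auto simp: Lambda1_ball_def)
qed

lemma openin_Lambda1_top: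
  assumes nn: "\<forall>n. 0 \<le> \<alpha> n"
  shows "openin (Lambda1_top \<alpha>) U \<longleftrightarrow>
    U \<subseteq> Lambda1 \<alpha> \<and> (\<forall>x\<in>U. \<exists>k\<ge>1. \<exists>e>0. Lambda1_ball \<alpha> k x e \<subseteq> U)" (is "?L \<longleftrightarrow> ?R U")
proof
  assume ?L
  then have "generate_topology_on {Lambda1_ball \<alpha> k x r | k x r. 1 \<le> k \<and> x \<in> Lambda1 \<alpha> \<and> 0 < r} U"
    by (simp add: Lambda1_top_def openin_topology_generated_by_iff)
  then show "?R U"
  proof induction
    case (Int a b)
    show ?case
    proof (intro conjI ballI)
      fix x assume x: "x \<in> a \<inter> b"
      obtain k e where 1: "1 \<le> k" "0 < e" "Lambda1_ball \<alpha> k x e \<subseteq> a" using Int x by blast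
      obtain l d where 2: "1 \<le> l" "0 < d" "Lambda1_ball \<alpha> l x d \<subseteq> b" using Int x by blast
      have "x \<in> Lambda1 \<alpha>" using x Int by blast
      then have "Lambda1_ball \<alpha> (max k l) x (min e d) \<subseteq> Lambda1_ball \<alpha> k x e \<inter> Lambda1_ball \<alpha> l x d"
        using Lambda1_norm_mono[OF Lambda1_diff nn, of _ x k "max k l"]
          Lambda1_norm_mono[OF Lambda1_diff nn, of _ x l "max k l"] 1(1) 2(1)
        unfolding Lambda1_ball_def by fastforce
      then show "\<exists>k\<ge>1. \<exists>e>0. Lambda1_ball \<alpha> k x e \<subseteq> a \<inter> b"
        using 1 2 by (intro exI[of _ "max k l"] conjI exI[of _ "min e d"]) auto
    qed (use Int in blast)
  next
    case (UN K)
    then show ?case by (meson Sup_least Union_iff Union_upper order_trans)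
  next
    case (Basis s)
    then obtain k x r where s: "s = Lambda1_ball \<alpha> k x r" "1 \<le> k" "x \<in> Lambda1 \<alpha>" by blast
    show ?case
    proof (intro conjI ballI)
      show "s \<subseteq> Lambda1 \<alpha>" unfolding s(1) Lambda1_ball_def by blast
      fix z assume "z \<in> s"
      then show "\<exists>k\<ge>1. \<exists>e>0. Lambda1_ball \<alpha> k z e \<subseteq> s"
        using Lambda1_ball_nested[OF _ s(3,2)] s(1,2) by blast
    qed
  qed auto
next
  assume R: "?R U"
  show ?L
  proof (subst openin_subopen, intro ballI)
    fix x assume x: "x \<in> U"
    with R obtain k e where ke: "1 \<le> k" "0 < e" "Lambda1_ball \<alpha> k x e \<subseteq> U" by blast
    have xX: "x \<in> Lambda1 \<alpha>" using R x by blast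
    have "openin (Lambda1_top \<alpha>) (Lambda1_ball \<alpha> k x e)"
      unfolding Lambda1_top_def using ke xX by (intro topology_generated_by_Basis) blast
    moreover have "x \<in> Lambda1_ball \<alpha> k x e"
      using xX ke by (simp add: Lambda1_ball_def Lambda1_norm_def)
    ultimately show "\<exists>T. openin (Lambda1_top \<alpha>) T \<and> x \<in> T \<and> T \<subseteq> U" using ke by blast
  qed
qed

lemma continuous_seminorm_Lambda1_norm:
  assumes nn: "\<forall>n. 0 \<le> \<alpha> n" and k: "1 \<le> k"
  shows "continuous_seminorm (Lambda1_top \<alpha>) (Lambda1_norm \<alpha> k :: (nat \<Rightarrow> 'a::real_normed_field) \<Rightarrow> real)"
  unfolding continuous_seminorm_def
proof (intro conjI ballI allI)
  show "continuous_map (Lambda1_top \<alpha>) euclideanreal (Lambda1_norm \<alpha> k :: (nat \<Rightarrow> 'a) \<Rightarrow> _)"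
    unfolding continuous_map_def
  proof (intro conjI allI impI)
    fix V :: "real set" assume "openin euclideanreal V"
    then have V: "open V" by simp
    show "openin (Lambda1_top \<alpha>) {x :: nat \<Rightarrow> 'a. x \<in> topspace (Lambda1_top \<alpha>) \<and> Lambda1_norm \<alpha> k x \<in> V}"
      unfolding openin_Lambda1_top[OF nn]
    proof (intro conjI ballI)
      fix x :: "nat \<Rightarrow> 'a" assume x: "x \<in> {x \<in> topspace (Lambda1_top \<alpha>). Lambda1_norm \<alpha> k x \<in> V}"
      then obtain e where e: "0 < e" "ball (Lambda1_norm \<alpha> k x) e \<subseteq> V"
        using V open_contains_ball by blast
      have "Lambda1_norm \<alpha> k y \<in> V" if y: "y \<in> Lambda1_ball \<alpha> k x e" for y
      proof -
        have yX: "y \<in> Lambda1 \<alpha>" "Lambda1_norm \<alpha> k (\<lambda>n. y n - x n) < e"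
          using y by (auto simp: Lambda1_ball_def)
        have "Lambda1_norm \<alpha> k y \<le> Lambda1_norm \<alpha> k (\<lambda>n. y n - x n) + Lambda1_norm \<alpha> k x"
          using Lambda1_norm_add[OF Lambda1_diff[OF yX(1), of x], of x k] x k by simp
        moreover have "Lambda1_norm \<alpha> k x \<le> Lambda1_norm \<alpha> k (\<lambda>n. y n - x n) + Lambda1_norm \<alpha> k y"
          using Lambda1_norm_add[OF Lambda1_diff[OF _ yX(1), of x], of y k] x k yX
          by (simp add: Lambda1_norm_minus[of _ _ x])
        ultimately show ?thesis using e yX by (auto simp: dist_real_def subset_iff)
      qed
      then show "\<exists>j\<ge>1. \<exists>e>0. Lambda1_ball \<alpha> j x e \<subseteq> {x \<in> topspace (Lambda1_top \<alpha>). Lambda1_norm \<alpha> k x \<in> V}"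
        using k e by (intro exI[of _ k] conjI exI[of _ e]) (auto simp: Lambda1_ball_def)
    qed auto
  qed auto
next
  fix c :: 'a and x y :: "nat \<Rightarrow> 'a"
  assume xy: "x \<in> topspace (Lambda1_top \<alpha>)"
  then have x: "x \<in> Lambda1 \<alpha>" by simp
  show "0 \<le> Lambda1_norm \<alpha> k x" by (rule Lambda1_norm_nonneg[OF x k])
  show "Lambda1_norm \<alpha> k (\<lambda>n. c * x n) = norm c * Lambda1_norm \<alpha> k x"
    by (rule Lambda1_norm_cmult[OF x k])
  show "Lambda1_norm \<alpha> k (\<lambda>n. x n + y n) \<le> Lambda1_norm \<alpha> k x + Lambda1_norm \<alpha> k y"
    if "y \<in> topspace (Lambda1_top \<alpha>)"
    using that by (intro Lambda1_norm_add x k) simp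
qed

lemma continuous_seminorm_Lambda1_bound:
  assumes nn: "\<forall>n. 0 \<le> \<alpha> n" and q: "continuous_seminorm (Lambda1_top \<alpha>) q"
  shows "\<exists>k\<ge>1. \<exists>C>0. \<forall>x\<in>Lambda1 \<alpha>. q x \<le> C * Lambda1_norm \<alpha> k x"
proof -
  have hom: "q (\<lambda>n. c * x n) = norm c * q x" if "x \<in> Lambda1 \<alpha>" for c x
    using q that by (simp add: continuous_seminorm_def)
  have q0: "q (\<lambda>_. 0) = 0" using hom[OF Lambda1_zero, of 0] by simp
  have "openin (Lambda1_top \<alpha>) {x \<in> topspace (Lambda1_top \<alpha>). q x \<in> {..<1}}"
    using q unfolding continuous_seminorm_def by (blast intro: openin_continuous_map_preimage open_openin[THEN iffD1] open_lessThan)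
  then obtain k e where k: "1 \<le> k" "0 < e"
    and sub: "Lambda1_ball \<alpha> k (\<lambda>_. 0) e \<subseteq> {x \<in> topspace (Lambda1_top \<alpha>). q x \<in> {..<1}}"
    unfolding openin_Lambda1_top[OF nn] using q0 Lambda1_zero[of \<alpha>] by force
  have *: "q x < 1" if "x \<in> Lambda1 \<alpha>" "Lambda1_norm \<alpha> k x < e" for x
    using sub that by (auto simp: Lambda1_ball_def)
  have "q x \<le> (1/e) * Lambda1_norm \<alpha> k x" if x: "x \<in> Lambda1 \<alpha>" for x
  proof (rule field_le_epsilon)
    fix d :: real assume d: "0 < d"
    define s where "s = Lambda1_norm \<alpha> k x + e * d"
    have s: "0 < s" "Lambda1_norm \<alpha> k x < s"
      using Lambda1_norm_nonneg[OF x k(1)] d k by (auto simp: s_def add_nonneg_pos)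
    have "Lambda1_norm \<alpha> k (\<lambda>n. of_real (e / s) * x n) < e"
      unfolding Lambda1_norm_cmult[OF x k(1)] norm_of_real using s k by (simp add: field_simps)
    from *[OF Lambda1_cmult[OF x] this] have "e / s * q x < 1"
      unfolding hom[OF x] using s k by (simp add: norm_divide)
    then have "q x < s / e" using s k by (simp add: field_simps)
    then show "q x \<le> (1/e) * Lambda1_norm \<alpha> k x + d" using k by (simp add: s_def field_simps)
  qed
  then show ?thesis using k by (intro exI[of _ k] conjI exI[of _ "1/e"]) auto
qed


definition unit_seq :: "nat \<Rightarrow> nat \<Rightarrow> 'a::real_normed_field" where
  "unit_seq n = (\<lambda>j. if j = n then 1 else 0)"

lemma unit_seq:
  "(unit_seq n :: nat \<Rightarrow> 'a::real_normed_field) \<in> Lambda1 \<alpha>"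
  "Lambda1_norm \<alpha> k (unit_seq n :: nat \<Rightarrow> 'a) = exp (- (1 / real k) * \<alpha> n)"
proof -
  have eq: "norm (unit_seq n j :: 'a) * exp (- (1 / real k) * \<alpha> j) = (if j = n then exp (- (1 / real k) * \<alpha> j) else 0)" for k j
    by (simp add: unit_seq_def)
  show "(unit_seq n :: nat \<Rightarrow> 'a) \<in> Lambda1 \<alpha>" unfolding Lambda1_def mem_Collect_eq eq by simp
  show "Lambda1_norm \<alpha> k (unit_seq n :: nat \<Rightarrow> 'a) = exp (- (1 / real k) * \<alpha> n)"
    unfolding Lambda1_norm_def eq using suminf_finite[of "{n}" "\<lambda>j. if j = n then exp (- (1 / real k) * \<alpha> j) else 0"] by simp
qed

lemma Lambda1_coord:
  assumes "x \<in> Lambda1 \<alpha>" "1 \<le> k"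
  shows "norm (x n) * exp (- (1 / real k) * \<alpha> n) \<le> Lambda1_norm \<alpha> k x"
  unfolding Lambda1_norm_def
  using sum_le_suminf[OF Lambda1_summable[OF assms], of "{n}"] by simp

lemma Lambda1_finsum:
  fixes N :: nat
  assumes "\<And>i. y i \<in> Lambda1 \<alpha>"
  shows "(\<lambda>n. \<Sum>i<N. c i * y i n) \<in> Lambda1 \<alpha>"
  by (induction N) (auto simp: Lambda1_zero intro!: Lambda1_add Lambda1_cmult assms)

theorem nuclear_Lambda1_iff:
  assumes nn: "\<forall>n. 0 \<le> \<alpha> n"
  shows "nuclear_space (Lambda1_top \<alpha> :: (nat \<Rightarrow> 'a::real_normed_field) topology) \<longleftrightarrow>
    (\<forall>k\<ge>1. \<exists>l>k. summable (\<lambda>n. exp (- (1 / real k) * \<alpha> n) / exp (- (1 / real l) * \<alpha> n)))"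
    (is "?L \<longleftrightarrow> ?R")
proof
  assume L: ?L
  show ?R
  proof (intro allI impI)
    fix k :: nat assume k: "1 \<le> k"
    define p where "p = (Lambda1_norm \<alpha> k :: (nat \<Rightarrow> 'a) \<Rightarrow> real)"
    have "continuous_seminorm (Lambda1_top \<alpha>) p"
      unfolding p_def by (rule continuous_seminorm_Lambda1_norm[OF nn k])
    from L[unfolded nuclear_space_def topspace_Lambda1_top, rule_format, OF this]
    obtain q where q: "continuous_seminorm (Lambda1_top \<alpha>) q"
      and ex: "\<exists>\<phi> y c.
            (\<forall>i. linear_functional_on (Lambda1 \<alpha>) (\<phi> i)) \<and>
            (\<forall>i. 0 \<le> c i \<and> (\<forall>x\<in>Lambda1 \<alpha>. norm (\<phi> i x) \<le> c i * q x)) \<and>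
            (\<forall>i. y i \<in> Lambda1 \<alpha>) \<and>
            summable (\<lambda>i. c i * p (y i)) \<and>
            (\<forall>x\<in>Lambda1 \<alpha>.
               (\<lambda>N. p (\<lambda>n. x n - (\<Sum>i<N. \<phi> i x * y i n))) \<longlonglongrightarrow> 0)"
      by blast
    from ex obtain \<phi> y c where
          c': "\<forall>i. 0 \<le> c i \<and> (\<forall>x\<in>Lambda1 \<alpha>. norm (\<phi> i x) \<le> c i * q x)"
      and y': "\<forall>i. y i \<in> Lambda1 \<alpha>" and sm: "summable (\<lambda>i. c i * p (y i))"
      and lim': "\<forall>x\<in>Lambda1 \<alpha>. (\<lambda>N. p (\<lambda>n. x n - (\<Sum>i<N. \<phi> i x * y i n))) \<longlonglongrightarrow> 0"
      by blast
    note c = c'[rule_format, THEN conjunct1] c'[rule_format, THEN conjunct2, rule_format]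
    note y = y'[rule_format] and lim = lim'[rule_format]
    obtain l' C where l': "1 \<le> l'" "0 < C" "\<And>x. x \<in> Lambda1 \<alpha> \<Longrightarrow> q x \<le> C * Lambda1_norm \<alpha> l' x"
      using continuous_seminorm_Lambda1_bound[OF nn q] by blast
    define l where "l = max l' (Suc k)"
    have l: "k < l" "1 \<le> l" "l' \<le> l" by (auto simp: l_def)
    have ql: "q x \<le> C * Lambda1_norm \<alpha> l x" if "x \<in> Lambda1 \<alpha>" for x
      using l'(3)[OF that] mult_left_mono[OF Lambda1_norm_mono[OF that nn l'(1) l(3)] less_imp_le[OF l'(2)]] by linarith
    define w where "w k n = exp (- (1 / real k) * \<alpha> n)" for k :: nat and n
    have w: "0 < w k n" for k n by (simp add: w_def)
    have smi: "summable (\<lambda>i. c i * (norm (y i n) * w k n))" for n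
      by (rule summable_comparison_test'[OF sm])
        (use c Lambda1_coord[OF y k] w in \<open>auto simp: p_def w_def abs_mult intro!: mult_left_mono\<close>)
    have key: "w k n / w l n \<le> C * (\<Sum>i. c i * (norm (y i n) * w k n))" for n
    proof -
      define x where "x = (unit_seq n :: nat \<Rightarrow> 'a)"
      have x: "x \<in> Lambda1 \<alpha>" "Lambda1_norm \<alpha> l x = w l n" "x n = 1"
        using unit_seq[where n=n and \<alpha>=\<alpha>, where 'a='a] by (auto simp: x_def w_def unit_seq_def)
      have ph: "norm (\<phi> i x) \<le> c i * (C * w l n)" for i
        using c(2)[OF x(1), of i] mult_left_mono[OF ql[OF x(1)] c(1)[of i]] unfolding x(2) by linarith
      have fin: "w k n \<le> p (\<lambda>n. x n - (\<Sum>i<N. \<phi> i x * y i n)) + C * w l n * (\<Sum>i. c i * (norm (y i n) * w k n))" for N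
      proof -
        have "norm (x n - (\<Sum>i<N. \<phi> i x * y i n)) * w k n \<le> p (\<lambda>n. x n - (\<Sum>i<N. \<phi> i x * y i n))"
          unfolding p_def w_def
          by (rule Lambda1_coord[OF Lambda1_diff[OF x(1) Lambda1_finsum[OF y]] k])
        moreover have "norm (\<Sum>i<N. \<phi> i x * y i n) * w k n \<le> C * w l n * (\<Sum>i. c i * (norm (y i n) * w k n))"
        proof -
          have "norm (\<Sum>i<N. \<phi> i x * y i n) * w k n \<le> (\<Sum>i<N. norm (\<phi> i x) * norm (y i n)) * w k n"
            using norm_sum[of "\<lambda>i. \<phi> i x * y i n" "{..<N}"] w[of k n]
            by (intro mult_right_mono) (auto simp: norm_mult)
          also have "\<dots> \<le> (\<Sum>i<N. (c i * (C * w l n)) * norm (y i n)) * w k n"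
            using w[of k n] by (intro mult_right_mono sum_mono ph) auto
          also have "\<dots> = C * w l n * (\<Sum>i<N. c i * (norm (y i n) * w k n))"
            by (simp add: sum_distrib_left sum_distrib_right algebra_simps)
          also have "\<dots> \<le> C * w l n * (\<Sum>i. c i * (norm (y i n) * w k n))"
            using l'(2) w[of l n] w[of k n] c(1) by (intro mult_left_mono sum_le_suminf smi) auto
          finally show ?thesis .
        qed
        moreover have "1 \<le> norm (x n - (\<Sum>i<N. \<phi> i x * y i n)) + norm (\<Sum>i<N. \<phi> i x * y i n)"
          using norm_triangle_ineq[of "x n - (\<Sum>i<N. \<phi> i x * y i n)" "\<Sum>i<N. \<phi> i x * y i n"] x(3) by simp
        then have "w k n \<le> norm (x n - (\<Sum>i<N. \<phi> i x * y i n)) * w k n + norm (\<Sum>i<N. \<phi> i x * y i n) * w k n"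
          using mult_right_mono[OF _ less_imp_le[OF w[of k n]]] unfolding distrib_right[symmetric] by fastforce
        ultimately show ?thesis by linarith
      qed
      have "w k n \<le> 0 + C * w l n * (\<Sum>i. c i * (norm (y i n) * w k n))"
        by (rule tendsto_lowerbound[OF tendsto_add[OF lim[OF x(1)] tendsto_const]])
          (use fin in auto)
      then show ?thesis using w[of l n] by (simp add: field_simps)
    qed
    have "summable (\<lambda>n. w k n / w l n)"
    proof (rule summableI_nonneg_bounded)
      fix N
      have "(\<Sum>n<N. w k n / w l n) \<le> (\<Sum>n<N. C * (\<Sum>i. c i * (norm (y i n) * w k n)))"
        by (intro sum_mono key)
      also have "\<dots> = C * (\<Sum>i. \<Sum>n<N. c i * (norm (y i n) * w k n))"
        by (subst suminf_sum[OF smi]) (simp add: sum_distrib_left)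
      also have "\<dots> \<le> C * (\<Sum>i. c i * p (y i))"
      proof (intro mult_left_mono suminf_le)
        fix i
        have "(\<Sum>n<N. norm (y i n) * w k n) \<le> p (y i)"
          unfolding p_def Lambda1_norm_def w_def
          by (intro sum_le_suminf Lambda1_summable y k) auto
        then show "(\<Sum>n<N. c i * (norm (y i n) * w k n)) \<le> c i * p (y i)"
          using c(1)[of i] by (simp add: sum_distrib_left[symmetric] mult_left_mono)
      qed (use l'(2) sm smi in \<open>auto intro: summable_sum\<close>)
      finally show "(\<Sum>n<N. w k n / w l n) \<le> C * (\<Sum>i. c i * p (y i))" .
    qed (use w in \<open>auto simp: less_imp_le\<close>)
    then show "\<exists>l>k. summable (\<lambda>n. exp (- (1 / real k) * \<alpha> n) / exp (- (1 / real l) * \<alpha> n))"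
      using l by (auto simp: w_def)
  qed
next
  assume R: ?R
  show ?L
    unfolding nuclear_space_def topspace_Lambda1_top
  proof (intro allI impI)
    fix p :: "(nat \<Rightarrow> 'a) \<Rightarrow> real" assume p: "continuous_seminorm (Lambda1_top \<alpha>) p"
    obtain k C where k: "1 \<le> k" "0 < C" and pk: "\<And>x. x \<in> Lambda1 \<alpha> \<Longrightarrow> p x \<le> C * Lambda1_norm \<alpha> k x"
      using continuous_seminorm_Lambda1_bound[OF nn p] by blast
    obtain l where l: "k < l"
      and sm: "summable (\<lambda>n. exp (- (1 / real k) * \<alpha> n) / exp (- (1 / real l) * \<alpha> n))"
      using R k by blast
    define q where "q x = C * Lambda1_norm \<alpha> l x" for x :: "nat \<Rightarrow> 'a"
    have l1: "1 \<le> l" using k l by simp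
    have q: "continuous_seminorm (Lambda1_top \<alpha>) q"
      using continuous_seminorm_Lambda1_norm[OF nn l1, where 'a='a] k(2)
      using continuous_map_real_mult[of "Lambda1_top \<alpha>" "\<lambda>_. C" "Lambda1_norm \<alpha> l :: (nat \<Rightarrow> 'a) \<Rightarrow> real"]
        mult_left_mono[of _ _ C]
      unfolding continuous_seminorm_def q_def
      by (simp add: distrib_left[symmetric] mult.left_commute)
    have pq: "\<forall>x\<in>Lambda1 \<alpha>. p x \<le> q x"
    proof
      fix x :: "nat \<Rightarrow> 'a" assume x: "x \<in> Lambda1 \<alpha>"
      show "p x \<le> q x"
        using pk[OF x] mult_left_mono[OF Lambda1_norm_mono[OF x nn k(1) less_imp_le[OF l]] less_imp_le[OF k(2)]]
        unfolding q_def by linarith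
    qed
    have pn: "0 \<le> p x" if "x \<in> Lambda1 \<alpha>" for x
      using p that by (simp add: continuous_seminorm_def)
    define c where "c i = inverse C * exp (1 / real l * \<alpha> i)" for i
    have c0: "0 \<le> c i" for i using k by (simp add: c_def)
    have b: "norm (x i) \<le> c i * q x" if "x \<in> Lambda1 \<alpha>" for i and x :: "nat \<Rightarrow> 'a"
      using Lambda1_coord[OF that l1, of i] k(2)
      by (simp add: c_def q_def exp_minus field_simps)
    have s: "summable (\<lambda>i. c i * p (unit_seq i))"
    proof (rule summable_comparison_test'[OF sm])
      fix i
      have "c i * p (unit_seq i) \<le> c i * (C * exp (- (1 / real k) * \<alpha> i))"
        using pk[OF unit_seq(1)[where n=i]] c0[of i] unfolding unit_seq(2) by (intro mult_left_mono)
      also have "\<dots> = exp (- (1 / real k) * \<alpha> i) / exp (- (1 / real l) * \<alpha> i)"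
        using k(2) by (simp add: c_def exp_minus field_simps)
      finally show "norm (c i * p (unit_seq i)) \<le> exp (- (1 / real k) * \<alpha> i) / exp (- (1 / real l) * \<alpha> i)"
        using c0[of i] pn[OF unit_seq(1)[where n=i]] by simp
    qed
    have t: "(\<lambda>N. p (\<lambda>n. x n - (\<Sum>i<N. x i * unit_seq i n))) \<longlonglongrightarrow> 0"
      if x: "x \<in> Lambda1 \<alpha>" for x :: "nat \<Rightarrow> 'a"
    proof -
      define f where "f n = norm (x n) * exp (- (1 / real k) * \<alpha> n)" for n
      have f: "summable f" unfolding f_def using Lambda1_summable[OF x k(1)] .
      have X: "(\<lambda>n. x n - (\<Sum>i<N. x i * unit_seq i n)) \<in> Lambda1 \<alpha>" for N
        by (intro Lambda1_diff x Lambda1_finsum unit_seq)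
      have e: "(\<lambda>n. x n - (\<Sum>i<N. x i * unit_seq i n)) = (\<lambda>n. if n < N then 0 else x n)" for N
        by (auto simp: unit_seq_def fun_eq_iff if_distrib sum.delta cong: if_cong)
      have tail: "Lambda1_norm \<alpha> k (\<lambda>n. x n - (\<Sum>i<N. x i * unit_seq i n)) = suminf f - sum f {..<N}" for N
      proof -
        have "(\<lambda>n. f n - (if n \<in> {..<N} then f n else 0)) sums (suminf f - sum f {..<N})"
          by (intro sums_diff summable_sums f sums_If_finite_set) auto
        moreover have "(\<lambda>n. f n - (if n \<in> {..<N} then f n else 0)) =
            (\<lambda>n. norm (if n < N then 0 else x n) * exp (- (1 / real k) * \<alpha> n))"
          by (auto simp: f_def)
        ultimately show ?thesis unfolding Lambda1_norm_def e by (simp add: sums_iff)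
      qed
      have "(\<lambda>N. C * (suminf f - sum f {..<N})) \<longlonglongrightarrow> C * (suminf f - suminf f)"
        by (intro tendsto_intros summable_LIMSEQ f)
      then have z: "(\<lambda>N. C * (suminf f - sum f {..<N})) \<longlonglongrightarrow> 0" by simp
      show ?thesis
        by (rule tendsto_sandwich[OF _ _ tendsto_const z])
          (use pn[OF X] pk[OF X] tail in auto)
    qed
    show "\<exists>q. continuous_seminorm (Lambda1_top \<alpha>) q \<and> (\<forall>x\<in>Lambda1 \<alpha>. p x \<le> q x) \<and>
         (\<exists>\<phi> y c.
            (\<forall>i. linear_functional_on (Lambda1 \<alpha>) (\<phi> i)) \<and>
            (\<forall>i. 0 \<le> c i \<and> (\<forall>x\<in>Lambda1 \<alpha>. norm (\<phi> i x) \<le> c i * q x)) \<and>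
            (\<forall>i. y i \<in> Lambda1 \<alpha>) \<and>
            summable (\<lambda>i. c i * p (y i)) \<and>
            (\<forall>x\<in>Lambda1 \<alpha>.
               (\<lambda>N. p (\<lambda>n. x n - (\<Sum>i<N. \<phi> i x * y i n))) \<longlonglongrightarrow> 0))"
    proof (intro exI[of _ q] conjI q pq, intro exI[of _ "\<lambda>i x. x i"] exI[of _ unit_seq] exI[of _ c] conjI allI ballI)
    qed (auto simp: c0 b s t unit_seq linear_functional_on_def)
  qed
qed

end

(* Since alpha is increasing, theta in the dual gives |theta_(j+n)| <= C exp(-alpha_n/K) uniformly in j, hence
   |(H x)_j| <= C ||x||_K for all j.  By nuclearity the weights exp(-beta_j/k) are summable for every k,
   so each box {y. |y_j| <= B for all j} is contained in Lambda_1(beta) and is precompact there; the unit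
   ball of ||.||_K is mapped into such a box. *)
theory Submission
  imports Defs
begin

section \<open>Estimates from nuclearity and from membership in the dual\<close>

text \<open>Since \<beta> is non-negative, the denominator in the Grothendieck-Pietsch quotient is
  at most 1, so the quotient dominates its numerator.\<close>

lemma nuclear_Lambda1_summable_weights:
  assumes "\<forall>n. 0 \<le> \<beta> n"
    and "nuclear_space (Lambda1_top \<beta> :: (nat \<Rightarrow> 'a::real_normed_field) topology)"
  shows "\<forall>k\<ge>1. summable (\<lambda>n. exp (- (1 / real k) * \<beta> n))"
proof (intro allI impI)
  fix k :: nat assume "1 \<le> k"
  then obtain l where "summable (\<lambda>n. exp (- (1 / real k) * \<beta> n) / exp (- (1 / real l) * \<beta> n))"
    using assms nuclear_Lambda1_iff[of \<beta>, where 'a='a] by blast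
  then show "summable (\<lambda>n. exp (- (1 / real k) * \<beta> n))"
  proof (rule summable_comparison_test')
    fix n
    have "exp (- (1 / real l) * \<beta> n) \<le> 1" using assms(1) by simp
    then show "norm (exp (- (1 / real k) * \<beta> n)) \<le> exp (- (1 / real k) * \<beta> n) / exp (- (1 / real l) * \<beta> n)"
      by (simp add: pos_le_divide_eq mult_left_le)
  qed
qed

text \<open>Monotonicity of \<alpha> lets the weight at \<open>j + n\<close> be replaced by the
  smaller weight at \<open>n\<close>. The bound is thus uniform in the row index
  \<open>j\<close>.\<close>

lemma Lambda1_dual_shift_bound:
  assumes "mono \<alpha>" "\<theta> \<in> Lambda1_dual \<alpha>"
  obtains K C where "1 \<le> K" "0 < C" "\<And>j n. norm (\<theta> (j + n)) \<le> C * exp (- (1 / real K) * \<alpha> n)"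
proof -
  obtain K where K: "1 \<le> K" "bdd_above (range (\<lambda>n. norm (\<theta> n) * exp ((1 / real K) * \<alpha> n)))"
    using assms(2) by (auto simp: Lambda1_dual_def)
  then obtain C' where C': "\<And>n. norm (\<theta> n) * exp ((1 / real K) * \<alpha> n) \<le> C'"
    by (auto simp: bdd_above_def)
  \<comment> \<open>The maximum with 1 makes the constant positive; the continuity proof divides by
    it.\<close>
  have "norm (\<theta> (j + n)) \<le> max C' 1 * exp (- (1 / real K) * \<alpha> n)" for j n
  proof -
    have "\<alpha> n \<le> \<alpha> (j + n)" using assms(1) by (simp add: monoD)
    then have "exp ((1 / real K) * \<alpha> n) \<le> exp ((1 / real K) * \<alpha> (j + n))"
      by (simp add: divide_right_mono)
    then have "norm (\<theta> (j + n)) * exp ((1 / real K) * \<alpha> n) \<le> max C' 1"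
      using C'[of "j + n"] mult_left_mono[OF _ norm_ge_zero[of "\<theta> (j + n)"]] by fastforce
    then show ?thesis by (simp add: exp_minus field_simps)
  qed
  then show thesis using that[of K "max C' 1"] K(1) by simp
qed

text \<open>Summable weights embed the bounded sequences continuously into \<Lambda>_1(\<beta>).
  Every estimate in the target space is reduced in this way to a bound uniform in the
  coordinates.\<close>

lemma bounded_seq_Lambda1:
  fixes y :: "nat \<Rightarrow> 'a::real_normed_field"
  assumes W: "\<forall>k\<ge>1. summable (\<lambda>n. exp (- (1 / real k) * \<beta> n))"
    and B: "\<And>j. norm (y j) \<le> B"
  shows "y \<in> Lambda1 \<beta>"
    and "1 \<le> k \<Longrightarrow> Lambda1_norm \<beta> k y \<le> B * (\<Sum>n. exp (- (1 / real k) * \<beta> n))"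
proof -
  have le: "norm (y n) * exp (- (1 / real k) * \<beta> n) \<le> B * exp (- (1 / real k) * \<beta> n)" for k n
    by (intro mult_right_mono B) simp
  show y: "y \<in> Lambda1 \<beta>"
    unfolding Lambda1_def
  proof (intro CollectI allI impI)
    fix k :: nat assume "1 \<le> k"
    from summable_mult[OF W[rule_format, OF this], of B]
    show "summable (\<lambda>n. norm (y n) * exp (- (1 / real k) * \<beta> n))"
      by (rule summable_comparison_test') (use le[of _ k] in simp)
  qed
  assume k: "1 \<le> k"
  show "Lambda1_norm \<beta> k y \<le> B * (\<Sum>n. exp (- (1 / real k) * \<beta> n))"
    unfolding Lambda1_norm_def suminf_mult[OF W[rule_format, OF k], symmetric]
    by (intro suminf_le le Lambda1_summable y k summable_mult W[rule_format])
qed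

section \<open>Convergence in power series spaces and of scalar series\<close>

text \<open>The balls around \<open>l\<close> are open and form a neighbourhood base at
  \<open>l\<close>, so convergence can be tested one seminorm at a time.\<close>

lemma limitin_Lambda1_top:
  assumes nn: "\<forall>n. 0 \<le> \<alpha> n"
  shows "limitin (Lambda1_top \<alpha>) f l F \<longleftrightarrow>
    l \<in> Lambda1 \<alpha> \<and> (\<forall>k\<ge>1. \<forall>e>0. eventually (\<lambda>i. f i \<in> Lambda1_ball \<alpha> k l e) F)"
proof (intro iffI conjI allI impI)
  assume L: "limitin (Lambda1_top \<alpha>) f l F"
  then show l: "l \<in> Lambda1 \<alpha>" by (auto simp: limitin_def)
  fix k :: nat and e :: real assume ke: "1 \<le> k" "0 < e"
  have "openin (Lambda1_top \<alpha>) (Lambda1_ball \<alpha> k l e)"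
    unfolding Lambda1_top_def using ke l by (intro topology_generated_by_Basis) blast
  moreover have "l \<in> Lambda1_ball \<alpha> k l e"
    using l ke by (simp add: Lambda1_ball_def Lambda1_norm_def)
  ultimately show "eventually (\<lambda>i. f i \<in> Lambda1_ball \<alpha> k l e) F"
    using L by (auto simp: limitin_def)
next
  assume R: "l \<in> Lambda1 \<alpha> \<and> (\<forall>k\<ge>1. \<forall>e>0. eventually (\<lambda>i. f i \<in> Lambda1_ball \<alpha> k l e) F)"
  show "limitin (Lambda1_top \<alpha>) f l F"
    unfolding limitin_def
  proof (intro conjI allI impI)
    fix U assume "openin (Lambda1_top \<alpha>) U \<and> l \<in> U"
    then obtain k e where "1 \<le> k" "0 < e" "Lambda1_ball \<alpha> k l e \<subseteq> U"
      unfolding openin_Lambda1_top[OF nn] by blast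
    with R show "eventually (\<lambda>i. f i \<in> U) F" by (metis (mono_tags, lifting) eventually_mono subsetD)
  qed (use R in simp)
qed

text \<open>Coordinate functionals are continuous. This makes limits of sequences unique, so the
  definite description in \<open>hankel\<close> has a value.\<close>

lemma limitin_Lambda1_top_coord:
  assumes nn: "\<forall>n. 0 \<le> \<alpha> n" and L: "limitin (Lambda1_top \<alpha>) f l F"
  shows "((\<lambda>i. f i j) \<longlongrightarrow> l j) F"
proof (rule tendstoI)
  fix e :: real assume e: "0 < e"
  have l: "l \<in> Lambda1 \<alpha>" using L limitin_Lambda1_top[OF nn] by blast
  \<comment> \<open>The factor \<open>exp (- \<alpha> j)\<close> in the radius cancels the weight of
    coordinate \<open>j\<close> in the first seminorm.\<close>
  have "eventually (\<lambda>i. f i \<in> Lambda1_ball \<alpha> 1 l (e * exp (- \<alpha> j))) F"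
    using L e unfolding limitin_Lambda1_top[OF nn] by simp
  then show "eventually (\<lambda>i. dist (f i j) (l j) < e) F"
  proof (rule eventually_mono)
    fix i assume *: "f i \<in> Lambda1_ball \<alpha> 1 l (e * exp (- \<alpha> j))"
    then have "f i \<in> Lambda1 \<alpha>" by (simp add: Lambda1_ball_def)
    from Lambda1_coord[OF Lambda1_diff[OF this l], of 1 j]
    have "norm (f i j - l j) * exp (- \<alpha> j) \<le> Lambda1_norm \<alpha> 1 (\<lambda>n. f i n - l n)" by simp
    also have "\<dots> < e * exp (- \<alpha> j)" using * by (simp add: Lambda1_ball_def)
    finally show "dist (f i j) (l j) < e" by (simp add: dist_norm)
  qed
qed

text \<open>Stated for \<open>complete_space\<close>: the sort \<open>{real_normed_field, heine_borel}\<close> is not below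
  \<open>banach\<close>, so the library's results on absolute convergence do not apply.\<close>

lemma abs_summable_complete:
  fixes f :: "nat \<Rightarrow> 'a::{real_normed_vector, complete_space}"
  assumes g: "summable g" and le: "\<And>n. norm (f n) \<le> g n"
  shows "summable f" and "norm (suminf f - sum f {..<N}) \<le> suminf g - sum g {..<N}"
proof -
  \<comment> \<open>This block estimate serves twice: for large \<open>m\<close> and
    \<open>n\<close> it gives the Cauchy property, and for \<open>m = N\<close> and \<open>n\<close>
    tending to infinity it gives the tail bound.\<close>
  have split: "norm (sum f {..<n} - sum f {..<m}) \<le> sum g {..<n} - sum g {..<m}" if "m \<le> n" for m n
  proof -
    have "sum f {..<n} - sum f {..<m} = sum f {m..<n}" "sum g {..<n} - sum g {..<m} = sum g {m..<n}"
      using that by (simp_all add: sum_diff_nat_ivl lessThan_atLeast0)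
    then show ?thesis using le by (simp add: sum_norm_le)
  qed
  have "Cauchy (\<lambda>n. sum f {..<n})"
    unfolding Cauchy_altdef
  proof (intro allI impI)
    fix e :: real assume "0 < e"
    moreover have "Cauchy (\<lambda>n. sum g {..<n})"
      using g by (simp add: summable_iff_convergent convergent_Cauchy)
    ultimately obtain M where M: "\<And>m n. M \<le> m \<Longrightarrow> m < n \<Longrightarrow> dist (sum g {..<m}) (sum g {..<n}) < e"
      unfolding Cauchy_altdef by blast
    show "\<exists>M. \<forall>m\<ge>M. \<forall>n>m. dist (sum f {..<m}) (sum f {..<n}) < e"
    proof (intro exI[of _ M] allI impI)
      fix m n assume "M \<le> m" "m < n"
      with M[of m n] split[of m n] show "dist (sum f {..<m}) (sum f {..<n}) < e"
        by (simp add: dist_norm norm_minus_commute)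
    qed
  qed
  then show f: "summable f"
    by (simp add: summable_iff_convergent Cauchy_convergent)
  show "norm (suminf f - sum f {..<N}) \<le> suminf g - sum g {..<N}"
  proof (rule tendsto_le[OF sequentially_bot])
    show "(\<lambda>n. norm (sum f {..<n} - sum f {..<N})) \<longlonglongrightarrow> norm (suminf f - sum f {..<N})"
      by (intro tendsto_intros summable_LIMSEQ f)
    show "(\<lambda>n. sum g {..<n} - sum g {..<N}) \<longlonglongrightarrow> suminf g - sum g {..<N}"
      by (intro tendsto_intros summable_LIMSEQ g)
    show "eventually (\<lambda>n. norm (sum f {..<n} - sum f {..<N}) \<le> sum g {..<n} - sum g {..<N}) sequentially"
      using split by (auto simp: eventually_sequentially)
  qed
qed

section \<open>Precompactness of coordinatewise bounded sets\<close>

text \<open>Coordinates beyond some \<open>N\<close> contribute little, uniformly on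
  \<open>A\<close>, because the weights are summable. The first \<open>N\<close> coordinates lie in
  a ball of the scalar field, which is totally bounded. A finite net therefore arises from finitely
  supported sequences.\<close>

lemma bounded_box_precompact:
  assumes nn: "\<forall>n. 0 \<le> \<beta> n"
    and W: "\<forall>k\<ge>1. summable (\<lambda>n. exp (- (1 / real k) * \<beta> n))"
    and A: "\<And>y j. y \<in> A \<Longrightarrow> norm (y j) \<le> B"
  shows "precompact_in (Lambda1_top \<beta>) (A :: (nat \<Rightarrow> 'a::{real_normed_field, heine_borel}) set)"
  unfolding precompact_in_def topspace_Lambda1_top
proof (intro conjI allI impI)
  have AX: "y \<in> Lambda1 \<beta>" if "y \<in> A" for y
    using A[OF that] by (rule bounded_seq_Lambda1(1)[OF W])
  then show "A \<subseteq> Lambda1 \<beta>" by blast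
  fix V :: "(nat \<Rightarrow> 'a) set" assume "zero_neighbourhood (Lambda1_top \<beta>) V"
  then obtain k e where k: "1 \<le> k" and e: "0 < e" and V: "Lambda1_ball \<beta> k (\<lambda>_. 0) e \<subseteq> V"
    unfolding zero_neighbourhood_def openin_Lambda1_top[OF nn] by blast
  define w where "w n = exp (- (1 / real k) * \<beta> n)" for n
  have sw: "summable w" unfolding w_def using W[rule_format, OF k] .
  have w0: "0 \<le> w n" for n by (simp add: w_def)
  \<comment> \<open>The error budget \<open>e\<close> is split in half between head and tail. The
    added 1 keeps the denominator positive and the head estimate strict.\<close>
  define d where "d = e / (2 * (suminf w + 1))"
  have S0: "0 \<le> suminf w" using sw w0 by (rule suminf_nonneg)
  have d: "0 < d" "d * suminf w < e / 2" using e S0 by (simp_all add: d_def field_simps)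
  have "(\<lambda>N. B * (suminf w - sum w {..<N})) \<longlonglongrightarrow> B * (suminf w - suminf w)"
    by (intro tendsto_intros summable_LIMSEQ sw)
  then have "eventually (\<lambda>N. B * (suminf w - sum w {..<N}) < e / 2) sequentially"
    using e by (intro order_tendstoD) auto
  then obtain N where N: "B * (suminf w - sum w {..<N}) < e / 2"
    by (auto simp: eventually_sequentially)
  obtain F where F: "finite F" "cball (0::'a) B \<subseteq> (\<Union>x\<in>F. ball x d)"
    using compact_cball[of "0::'a" B] d(1) compact_eq_totally_bounded by blast
  \<comment> \<open>The net consists of all sequences whose first \<open>N\<close> entries come from
    the scalar net \<open>F\<close> and whose other entries vanish. Since \<open>trunc\<close>
    ignores arguments from \<open>N\<close> on, the extensional functions in \<open>PiE\<close>
    yield all of them, and there are finitely many.\<close>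
  define trunc where "trunc g = (\<lambda>j. if j < N then g j else (0::'a))" for g
  define M where "M = trunc ` PiE {..<N} (\<lambda>_. F)"
  have M: "x \<in> Lambda1 \<beta>" if "x \<in> M" for x
  proof (rule bounded_seq_Lambda1(1)[OF W])
    fix j
    show "norm (x j) \<le> (\<Sum>n<N. norm (x n))"
    proof (cases "j < N")
      case True
      then show ?thesis by (intro member_le_sum) auto
    next
      case False
      obtain g where "x = trunc g" using \<open>x \<in> M\<close> unfolding M_def by (rule imageE)
      then have "x j = 0" using False by (simp add: trunc_def)
      then show ?thesis by (simp add: sum_nonneg)
    qed
  qed
  show "\<exists>M. finite M \<and> M \<subseteq> Lambda1 \<beta> \<and> A \<subseteq> (\<Union>x\<in>M. (\<lambda>v n. x n + v n) ` V)"
  proof (intro exI[of _ M] conjI subsetI)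
    show "finite M" unfolding M_def using F(1) by (intro finite_imageI finite_PiE) auto
    show "x \<in> Lambda1 \<beta>" if "x \<in> M" for x using M that .
    fix y assume y: "y \<in> A"
    have "\<exists>c\<in>F. dist c (y j) < d" for j
      using F(2) A[OF y, of j] by (force simp: mem_cball)
    then obtain c where c: "\<And>j. c j \<in> F" "\<And>j. dist (c j) (y j) < d" by metis
    define x where "x = trunc c"
    have "x = trunc (restrict c {..<N})" by (auto simp: x_def trunc_def)
    moreover have "restrict c {..<N} \<in> PiE {..<N} (\<lambda>_. F)" using c(1) by simp
    ultimately have xM: "x \<in> M" unfolding M_def by (rule image_eqI)
    define v where "v = (\<lambda>n. y n - x n)"
    have v: "v \<in> Lambda1 \<beta>" unfolding v_def
      using AX[OF y] M[OF xM] by (rule Lambda1_diff)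
    \<comment> \<open>Below \<open>N\<close> the entries of \<open>v\<close> are at most
      \<open>d\<close>; from \<open>N\<close> on \<open>v\<close> agrees with \<open>y\<close> and
      is bounded by \<open>B\<close>. The bracket is the weight with its first \<open>N\<close>
      terms removed, written as a difference so that its series is the full sum minus a finite
      sum.\<close>
    have "Lambda1_norm \<beta> k v \<le> (\<Sum>n. d * w n + B * (w n - (if n \<in> {..<N} then w n else 0)))"
      unfolding Lambda1_norm_def w_def[symmetric]
    proof (rule suminf_le)
      fix n
      show "norm (v n) * w n \<le> d * w n + B * (w n - (if n \<in> {..<N} then w n else 0))"
      proof (cases "n < N")
        case True
        then have "norm (v n) \<le> d" using c(2)[of n]
          by (simp add: v_def x_def trunc_def dist_norm norm_minus_commute)
        then show ?thesis using True w0 by (simp add: mult_right_mono)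
      next
        case False
        then have "norm (v n) \<le> B" using A[OF y] by (simp add: v_def x_def trunc_def)
        then have "norm (v n) * w n \<le> B * w n" by (intro mult_right_mono w0)
        then show ?thesis using False w0[of n] d(1) by (simp add: add_increasing)
      qed
    next
      show "summable (\<lambda>n. norm (v n) * w n)" unfolding w_def by (rule Lambda1_summable[OF v k])
      show "summable (\<lambda>n. d * w n + B * (w n - (if n \<in> {..<N} then w n else 0)))"
        by (intro summable_add summable_mult summable_diff sw summable_If_finite_set) simp
    qed
    also have "\<dots> = d * suminf w + B * (suminf w - sum w {..<N})"
      by (intro sums_unique[symmetric] sums_add sums_mult sums_diff summable_sums sw sums_If_finite_set) simp
    also have "\<dots> < e" using N d(2) by linarith
    finally have "v \<in> V" using V v by (auto simp: Lambda1_ball_def)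
    moreover have "y = (\<lambda>n. x n + v n)" by (simp add: v_def)
    ultimately show "y \<in> (\<Union>x\<in>M. (\<lambda>v n. x n + v n) ` V)" using xM by blast
  qed
qed

section \<open>The Hankel operator as a coordinatewise series\<close>

text \<open>All rows are dominated by one summable sequence \<open>g\<close>. The partial sums
  therefore converge uniformly in \<open>j\<close>, which by \<open>bounded_seq_Lambda1\<close> is
  enough for convergence in every seminorm of \<Lambda>_1(\<beta>).\<close>

lemma hankel_Lambda1:
  fixes \<theta> x :: "nat \<Rightarrow> 'a::{real_normed_field, heine_borel}"
  assumes nn: "\<forall>n. 0 \<le> \<beta> n"
    and W: "\<forall>k\<ge>1. summable (\<lambda>n. exp (- (1 / real k) * \<beta> n))"
    and K: "1 \<le> K" and C: "\<And>j n. norm (\<theta> (j + n)) \<le> C * exp (- (1 / real K) * \<alpha> n)"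
    and x: "x \<in> Lambda1 \<alpha>"
  shows "summable (\<lambda>n. x n * \<theta> (j + n))"
    and "norm (\<Sum>n. x n * \<theta> (j + n)) \<le> C * Lambda1_norm \<alpha> K x"
    and "hankel_sums (Lambda1_top \<beta>) \<theta> x (\<lambda>j. \<Sum>n. x n * \<theta> (j + n))"
    and "hankel (Lambda1_top \<beta>) \<theta> x = (\<lambda>j. \<Sum>n. x n * \<theta> (j + n))"
proof -
  define g where "g n = C * (norm (x n) * exp (- (1 / real K) * \<alpha> n))" for n
  have g: "summable g" unfolding g_def by (intro summable_mult Lambda1_summable x K)
  have le: "norm (x n * \<theta> (j + n)) \<le> g n" for j n
    using mult_left_mono[OF C[of j n] norm_ge_zero[of "x n"]] by (simp add: g_def norm_mult mult_ac)
  show "summable (\<lambda>n. x n * \<theta> (j + n))" for j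
    using g le by (rule abs_summable_complete(1))
  have tail: "norm ((\<Sum>n. x n * \<theta> (j + n)) - (\<Sum>n<N. x n * \<theta> (j + n))) \<le> suminf g - sum g {..<N}" for j N
    using g le by (rule abs_summable_complete(2))
  have sg: "suminf g = C * Lambda1_norm \<alpha> K x"
    unfolding g_def Lambda1_norm_def by (intro suminf_mult Lambda1_summable x K)
  \<comment> \<open>This is the tail estimate with no terms removed.\<close>
  show bd: "norm (\<Sum>n. x n * \<theta> (j + n)) \<le> C * Lambda1_norm \<alpha> K x" for j
    using tail[of j 0] sg by simp
  define y where "y = (\<lambda>j. \<Sum>n. x n * \<theta> (j + n))"
  define s where "s N j = (\<Sum>n<N. x n * \<theta> (j + n))" for N j
  have sy: "norm (s N j - y j) \<le> suminf g - sum g {..<N}" for N j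
    using tail[of j N] by (simp add: s_def y_def norm_minus_commute)
  have y: "y \<in> Lambda1 \<beta>" unfolding y_def using bd by (rule bounded_seq_Lambda1(1)[OF W])
  have "limitin (Lambda1_top \<beta>) s y sequentially"
    unfolding limitin_Lambda1_top[OF nn]
  proof (intro conjI allI impI y)
    fix k :: nat and e :: real assume k: "1 \<le> k" and e: "0 < e"
    define S where "S = (\<Sum>n. exp (- (1 / real k) * \<beta> n))"
    have "(\<lambda>N. (suminf g - sum g {..<N}) * S) \<longlonglongrightarrow> (suminf g - suminf g) * S"
      by (intro tendsto_intros summable_LIMSEQ g)
    then have "eventually (\<lambda>N. (suminf g - sum g {..<N}) * S < e) sequentially"
      using e by (intro order_tendstoD) auto
    then show "eventually (\<lambda>N. s N \<in> Lambda1_ball \<beta> k y e) sequentially"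
    proof (rule eventually_mono)
      fix N assume N: "(suminf g - sum g {..<N}) * S < e"
      \<comment> \<open>The difference is bounded by a tail of \<open>g\<close>, hence lies in the
        space; adding \<open>y\<close> back gives membership of \<open>s N\<close>.\<close>
      have "(\<lambda>j. s N j - y j) \<in> Lambda1 \<beta>"
        using sy[of N] by (rule bounded_seq_Lambda1(1)[OF W])
      from Lambda1_add[OF this y] have "s N \<in> Lambda1 \<beta>" by simp
      moreover have "Lambda1_norm \<beta> k (\<lambda>j. s N j - y j) \<le> (suminf g - sum g {..<N}) * S"
        unfolding S_def using sy[of N] k by (rule bounded_seq_Lambda1(2)[OF W])
      ultimately show "s N \<in> Lambda1_ball \<beta> k y e" using N by (simp add: Lambda1_ball_def)
    qed
  qed
  then have H: "hankel_sums (Lambda1_top \<beta>) \<theta> x y"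
    by (simp add: hankel_sums_def hankel_column_def s_def[abs_def])
  then show "hankel_sums (Lambda1_top \<beta>) \<theta> x (\<lambda>j. \<Sum>n. x n * \<theta> (j + n))" by (simp add: y_def)
  show "hankel (Lambda1_top \<beta>) \<theta> x = (\<lambda>j. \<Sum>n. x n * \<theta> (j + n))"
    unfolding hankel_def y_def[symmetric]
  proof (rule the_equality[where P="hankel_sums (Lambda1_top \<beta>) \<theta> x", OF H])
    fix z assume z: "hankel_sums (Lambda1_top \<beta>) \<theta> x z"
    show "z = y"
    proof
      fix j
      show "z j = y j"
        using limitin_Lambda1_top_coord[OF nn z[unfolded hankel_sums_def], of j]
          limitin_Lambda1_top_coord[OF nn H[unfolded hankel_sums_def], of j] by (rule LIMSEQ_unique)
    qed
  qed
qed

section \<open>Well-definedness, continuity and compactness\<close>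

theorem theorem3p15:
  fixes \<alpha> \<beta> :: "nat \<Rightarrow> real"
    and \<theta> :: "nat \<Rightarrow> 'a::{real_normed_field, heine_borel}"
  assumes "exponent_sequence \<alpha>" and "exponent_sequence \<beta>"
    and "nuclear_space (Lambda1_top \<beta> :: (nat \<Rightarrow> 'a) topology)"
    and "\<theta> \<in> Lambda1_dual \<alpha>"
  shows "hankel_well_defined (Lambda1_top \<alpha>) (Lambda1_top \<beta>) \<theta> \<and>
    continuous_map (Lambda1_top \<alpha>) (Lambda1_top \<beta>) (hankel (Lambda1_top \<beta>) \<theta>) \<and>
    compact_operator (Lambda1_top \<alpha>) (Lambda1_top \<beta>) (hankel (Lambda1_top \<beta>) \<theta>)"
proof -
  have nna: "\<forall>n. 0 \<le> \<alpha> n" and nnb: "\<forall>n. 0 \<le> \<beta> n" and "mono \<alpha>"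
    using assms by (auto simp: exponent_sequence_def)
  obtain K C where K: "1 \<le> K" and C0: "0 < C"
    and C: "\<And>j n. norm (\<theta> (j + n)) \<le> C * exp (- (1 / real K) * \<alpha> n)"
    using Lambda1_dual_shift_bound[OF \<open>mono \<alpha>\<close> assms(4)] by blast
  note W = nuclear_Lambda1_summable_weights[OF nnb assms(3)]
  define H where "H = hankel (Lambda1_top \<beta>) \<theta>"
  have sm: "summable (\<lambda>n. x n * \<theta> (j + n))" if "x \<in> Lambda1 \<alpha>" for x j
    using that by (rule hankel_Lambda1(1)[where \<theta>=\<theta> and \<alpha>=\<alpha>, OF nnb W K C])
  have H: "H x = (\<lambda>j. \<Sum>n. x n * \<theta> (j + n))" if "x \<in> Lambda1 \<alpha>" for x
    unfolding H_def using that by (rule hankel_Lambda1(4)[where \<theta>=\<theta> and \<alpha>=\<alpha>, OF nnb W K C])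
  have bound: "norm (H x j) \<le> C * Lambda1_norm \<alpha> K x" if "x \<in> Lambda1 \<alpha>" for x j
    unfolding H[OF that] using that by (rule hankel_Lambda1(2)[where \<theta>=\<theta> and \<alpha>=\<alpha>, OF nnb W K C])
  have mem: "H x \<in> Lambda1 \<beta>" if "x \<in> Lambda1 \<alpha>" for x
    using bound[OF that] by (rule bounded_seq_Lambda1(1)[OF W])
  have add: "H (\<lambda>n. x n + y n) = (\<lambda>n. H x n + H y n)" if "x \<in> Lambda1 \<alpha>" "y \<in> Lambda1 \<alpha>" for x y
    using that by (simp add: H Lambda1_add distrib_right suminf_add sm)
  have cmult: "H (\<lambda>n. c * x n) = (\<lambda>n. c * H x n)" if "x \<in> Lambda1 \<alpha>" for c x
    using that by (simp add: H Lambda1_cmult mult.assoc suminf_mult sm)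
  have diff: "H (\<lambda>n. x n - y n) = (\<lambda>n. H x n - H y n)" if "x \<in> Lambda1 \<alpha>" "y \<in> Lambda1 \<alpha>" for x y
    using add[OF that(1) Lambda1_cmult[OF that(2), of "-1"]] cmult[OF that(2), of "-1"] by simp
  have "hankel_well_defined (Lambda1_top \<alpha>) (Lambda1_top \<beta>) \<theta>"
    unfolding hankel_well_defined_def topspace_Lambda1_top
  proof (intro conjI allI ballI)
    \<comment> \<open>For fixed \<open>n\<close> the shift bound does not depend on
      \<open>j\<close>, so each column is a bounded sequence.\<close>
    show "hankel_column \<theta> n \<in> Lambda1 \<beta>" for n
      unfolding hankel_column_def using C[of _ n] by (rule bounded_seq_Lambda1(1)[OF W])
    show "\<exists>y. hankel_sums (Lambda1_top \<beta>) \<theta> x y" if "x \<in> Lambda1 \<alpha>" for x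
      using hankel_Lambda1(3)[where \<theta>=\<theta> and \<alpha>=\<alpha>, OF nnb W K C that] by blast
  qed
  moreover have "continuous_map (Lambda1_top \<alpha>) (Lambda1_top \<beta>) H"
    unfolding continuous_map_def topspace_Lambda1_top
  proof (intro conjI allI impI)
    show "H \<in> Lambda1 \<alpha> \<rightarrow> Lambda1 \<beta>" using mem by blast
    fix U :: "(nat \<Rightarrow> 'a) set" assume U: "openin (Lambda1_top \<beta>) U"
    show "openin (Lambda1_top \<alpha>) {x \<in> Lambda1 \<alpha>. H x \<in> U}"
      unfolding openin_Lambda1_top[OF nna]
    proof (intro conjI ballI)
      fix x assume "x \<in> {x \<in> Lambda1 \<alpha>. H x \<in> U}"
      then have x: "x \<in> Lambda1 \<alpha>" "H x \<in> U" by auto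
      then obtain k e where k: "1 \<le> k" "0 < e" "Lambda1_ball \<beta> k (H x) e \<subseteq> U"
        using U unfolding openin_Lambda1_top[OF nnb] by blast
      define S where "S = (\<Sum>n. exp (- (1 / real k) * \<beta> n))"
      have S: "0 < S" unfolding S_def by (intro suminf_pos W[rule_format] k) simp
      \<comment> \<open>The radius comes from bounding the \<open>k\<close>-th seminorm of
        \<open>H (z - x)\<close> by \<open>C * S\<close> times the \<open>K\<close>-th seminorm of
        \<open>z - x\<close>. The same \<open>K\<close> serves every \<open>k\<close>; only
        \<open>S\<close> depends on \<open>k\<close>.\<close>
      have "H z \<in> U" if z: "z \<in> Lambda1_ball \<alpha> K x (e / (C * S))" for z
      proof -
        have z': "z \<in> Lambda1 \<alpha>" "Lambda1_norm \<alpha> K (\<lambda>n. z n - x n) < e / (C * S)"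
          using z by (auto simp: Lambda1_ball_def)
        have "Lambda1_norm \<beta> k (H (\<lambda>n. z n - x n)) \<le> C * Lambda1_norm \<alpha> K (\<lambda>n. z n - x n) * S"
          unfolding S_def
          using bound[OF Lambda1_diff[OF z'(1) x(1)]] k(1) by (rule bounded_seq_Lambda1(2)[OF W])
        also have "\<dots> < e" using z'(2) C0 S by (simp add: field_simps)
        finally show ?thesis
          using k(3) mem[OF z'(1)] unfolding diff[OF z'(1) x(1)] by (auto simp: Lambda1_ball_def)
      qed
      then show "\<exists>k\<ge>1. \<exists>e>0. Lambda1_ball \<alpha> k x e \<subseteq> {x \<in> Lambda1 \<alpha>. H x \<in> U}"
        using K k(2) C0 S by (intro exI[of _ K] conjI exI[of _ "e / (C * S)"]) (auto simp: Lambda1_ball_def)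
    qed auto
  qed
  moreover have "compact_operator (Lambda1_top \<alpha>) (Lambda1_top \<beta>) H"
    unfolding compact_operator_def topspace_Lambda1_top
  proof (intro conjI exI)
    show "linear_operator_on (Lambda1 \<alpha>) (Lambda1 \<beta>) H"
      using mem add cmult by (auto simp: linear_operator_on_def)
    define U where "U = Lambda1_ball \<alpha> K (\<lambda>_. 0 :: 'a) 1"
    have "openin (Lambda1_top \<alpha>) U"
      unfolding U_def Lambda1_top_def using K Lambda1_zero zero_less_one
      by (intro topology_generated_by_Basis) blast
    then show "zero_neighbourhood (Lambda1_top \<alpha>) U"
      unfolding zero_neighbourhood_def
      by (auto simp: U_def Lambda1_ball_def Lambda1_zero Lambda1_norm_def)
    \<comment> \<open>This one neighbourhood \<open>U\<close> is sent into the box of radius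
      \<open>C\<close>.\<close>
    have UC: "norm (H x j) \<le> C" if "x \<in> U" for x j
    proof -
      have x: "x \<in> Lambda1 \<alpha>" "Lambda1_norm \<alpha> K x \<le> 1" using that by (auto simp: U_def Lambda1_ball_def)
      have "C * Lambda1_norm \<alpha> K x \<le> C" using x(2) C0 by simp
      with bound[OF x(1), of j] show ?thesis by linarith
    qed
    show "precompact_in (Lambda1_top \<beta>) (H ` U)"
      using nnb W by (rule bounded_box_precompact) (use UC in auto)
  qed
  ultimately show ?thesis by (simp add: H_def)
qed

end
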